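(* For every integer $k\ge 4$ there exist $q\in\mathbb N$ and $c>0$ such that for all sufficiently large $t$, $$r_k(t;q,5)\ge T_{k-1}(t^c).$$
   Context: $K_n^{(k)}$ is the complete $k$-uniform hypergraph on $n$ vertices. For integers $q\ge p$, $r_k(t;q,p)$ is the smallest integer $n$ such that in every colouring of the edges of $K_n^{(k)}$ with $q$ colours there is a set of $t$ vertices such that the $k$-edges contained in it receive fewer than $p$ distinct colours in total. The tower function is defined by $T_1(x)=x$ and $T_{i+1}(x)=2^{T_i(x)}$. *)

theory Defs
  imports Complex_Main "HOL-Library.Ramsey"
begin

fun tower :: "nat \<Rightarrow> real \<Rightarrow> real" where
  "tower 0 x = x" \<comment> \<open>junk value: the tower function is indexed from 1\<close>
| "tower (Suc 0) x = x"
| "tower (Suc (Suc i)) x = 2 powr tower (Suc i) x"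

text \<open>
  The edges of the complete k-uniform hypergraph on the vertex set \<open>V\<close> are the members of
  \<open>nsets V k\<close>; a colouring with \<open>q\<close> colours need not use all of them. Colour values outside
  the edge set are irrelevant.
\<close>

definition few_colours_arrow :: "nat \<Rightarrow> nat \<Rightarrow> nat \<Rightarrow> nat \<Rightarrow> nat \<Rightarrow> bool" where
  "few_colours_arrow k n t q p \<longleftrightarrow>
     (\<forall>f \<in> nsets {..<n} k \<rightarrow> {..<q}. \<exists>S \<in> nsets {..<n} t. card (f ` nsets S k) < p)"

definition ramsey_num :: "nat \<Rightarrow> nat \<Rightarrow> nat \<Rightarrow> nat \<Rightarrow> nat" where
  "ramsey_num k t q p = (LEAST n. few_colours_arrow k n t q p)"

text \<open>For \<open>p \<ge> 2\<close> the minimum is over a nonempty set, by Ramsey's theorem.\<close>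

lemma few_colours_arrow_exists:
  assumes "p \<ge> 2"
  shows "\<exists>n. few_colours_arrow k n t q p"
proof -
  obtain N :: nat where N: "partn_lst {..<N} (replicate q t) k"
    using ramsey_full by blast
  have "few_colours_arrow k N t q p"
    unfolding few_colours_arrow_def
  proof
    fix f assume "f \<in> nsets {..<N} k \<rightarrow> {..<q}"
    then obtain i S where i: "i < q" and S: "S \<in> nsets {..<N} t" and m: "f ` nsets S k \<subseteq> {i}"
      using N unfolding partn_lst_def monochromatic_def by fastforce
    have "card (f ` nsets S k) \<le> card {i}"
      using m by (intro card_mono) auto
    then show "\<exists>S \<in> nsets {..<N} t. card (f ` nsets S k) < p"
      using S assms by (intro bexI[of _ S]) auto
  qed
  then show ?thesis by blast
qed

end

theory Submission
  imports Defs
begin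

text \<open>
  For \<open>k = 3\<close> a random 5-colouring of the triples of fewer than \<open>2\<^sup>t\<close> vertices shows every colour on
  every \<open>t\<close>-set. Stepping up from \<open>k\<close> to \<open>k + 1\<close> replaces \<open>M\<close> vertices by the \<open>2\<^sup>M\<close> binary words of
  length \<open>M\<close>, where \<open>\<delta>(u, v)\<close> is the highest position in which \<open>u\<close> and \<open>v\<close> differ. The new colour of
  \<open>v\<^sub>1 < \<dots> < v\<^sub>k\<^sub>+\<^sub>1\<close> records the old colour of the set of consecutive \<open>\<delta>\<close>'s together with the order
  pattern of the first three of them, where \<open>123\<close>, \<open>321\<close>, \<open>213\<close>, \<open>312\<close> are distinguished and the
  three patterns with a peak in the middle are identified. A set of \<open>t\<close> words is the set of leaves of
  a binary tree. If \<open>\<delta>\<close> is monotone on some \<open>s + 1\<close> of these words, the old colouring provides 5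
  colours. Otherwise the tree has depth \<open>O(s)\<close>, and if \<open>t\<close> exceeds a fixed power of \<open>s\<close> it contains
  a complete binary tree of depth \<open>k + 1\<close>, in which all 5 patterns occur. The patterns with a peak
  have to be identified because one does not control how the splits in the two halves compare.
\<close>

section \<open>Random colourings\<close>

lemma not_few_colours_arrow_iff:
  "\<not> few_colours_arrow k n t q p \<longleftrightarrow>
     (\<exists>f \<in> nsets {..<n} k \<rightarrow> {..<q}. \<forall>S \<in> nsets {..<n} t. p \<le> card (f ` nsets S k))"
  unfolding few_colours_arrow_def by (auto simp: not_less)

text \<open>Omitting \<open>i\<close> on \<open>F\<close> is a condition on each edge separately, so
  these colourings form a product set.\<close>

lemma card_PiE_omit:
  assumes "finite E" "F \<subseteq> E" "i < q"
  shows "card {f \<in> E \<rightarrow>\<^sub>E {..<q}. i \<notin> f ` F} = (q - 1) ^ card F * q ^ (card E - card F)"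
proof -
  have eq: "{f \<in> E \<rightarrow>\<^sub>E {..<q}. i \<notin> f ` F} = (\<Pi>\<^sub>E x\<in>E. if x \<in> F then {..<q} - {i} else {..<q})"
    using \<open>F \<subseteq> E\<close> by (fastforce simp: PiE_def Pi_def split: if_splits)
  have "card {f \<in> E \<rightarrow>\<^sub>E {..<q}. i \<notin> f ` F}
      = (\<Prod>x\<in>E. if x \<in> F then q - 1 else q)"
    unfolding eq using assms by (subst card_PiE) (auto intro!: prod.cong)
  also have "\<dots> = (q - 1) ^ card F * q ^ card (E - F)"
    using assms by (simp add: prod.If_cases Int_absorb1 Diff_eq)
  also have "card (E - F) = card E - card F"
    using assms by (meson card_Diff_subset finite_subset)
  finally show ?thesis .
qed

text \<open>Union bound by counting: there are at most \<open>q * n ^ t\<close> pairs of a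
  \<open>t\<close>-set and a colour, and each colour is missed on each set by the fraction ((q - 1)
  / q) ^ (t choose k) of all colourings.\<close>

lemma exists_colouring_all_colours:
  fixes n q :: nat
  assumes q0: "q > 0" and less: "q * n ^ t * (q - 1) ^ (t choose k) < q ^ (t choose k)"
  shows "\<exists>f \<in> nsets {..<n} k \<rightarrow> {..<q}. \<forall>S \<in> nsets {..<n} t. f ` nsets S k = {..<q}"
proof -
  define E where "E = nsets {..<n} k"
  define b where "b = t choose k"
  define bad where "bad = (\<lambda>(S, i). {f \<in> E \<rightarrow>\<^sub>E {..<q}. i \<notin> f ` nsets S k})"
  define I where "I = nsets {..<n} t \<times> {..<q}"
  have finE: "finite E" unfolding E_def by (simp add: finite_imp_finite_nsets)
  have finI: "finite I" unfolding I_def by (simp add: finite_imp_finite_nsets)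
  have fin: "finite (E \<rightarrow>\<^sub>E {..<q})" using finE by (simp add: finite_PiE)
  have cbad: "card (bad p) = (q - 1) ^ b * q ^ (card E - b)" and bE: "b \<le> card E"
    if "p \<in> I" for p
  proof -
    obtain S i where p: "p = (S, i)" "S \<in> nsets {..<n} t" "i \<in> {..<q}"
      using \<open>p \<in> I\<close> unfolding I_def by blast
    have sub: "nsets S k \<subseteq> E" unfolding E_def using p(2) by (intro nsets_mono) (auto simp: nsets_def)
    have c: "card (nsets S k) = b" using p(2) unfolding b_def card_nsets by (simp add: nsets_def)
    show "card (bad p) = (q - 1) ^ b * q ^ (card E - b)"
      unfolding bad_def p(1) using card_PiE_omit[OF finE sub, of i q] p(3) c by simp
    show "b \<le> card E" using card_mono[OF finE sub] c by simp
  qed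
  have "\<exists>f \<in> E \<rightarrow>\<^sub>E {..<q}. \<forall>p\<in>I. f \<notin> bad p"
  proof (rule ccontr)
    assume contra: "\<not> ?thesis"
    have sub: "E \<rightarrow>\<^sub>E {..<q} \<subseteq> (\<Union>p\<in>I. bad p)" using contra by auto
    \<comment> \<open>A covered nonempty space yields some pair in \<open>I\<close>, hence
      \<open>b \<le> card E\<close>. Without this the truncated difference \<open>card E - b\<close>
      could not be cancelled.\<close>
    have ne: "E \<rightarrow>\<^sub>E {..<q} \<noteq> {}" using q0 by (auto simp: PiE_eq_empty_iff)
    then obtain p0 where "p0 \<in> I" using sub by blast
    note bE' = bE[OF this]
    have "n choose t \<le> n ^ t"
      by (cases "t \<le> n") (simp_all add: binomial_le_pow binomial_eq_0)
    then have cI: "card I \<le> q * n ^ t"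
      unfolding I_def by (simp add: card_cartesian_product)
    have "q ^ b * q ^ (card E - b) = q ^ card E" using bE' by (simp flip: power_add)
    also have "\<dots> = card (E \<rightarrow>\<^sub>E {..<q})" using finE by (simp add: card_PiE)
    also have "\<dots> \<le> card (\<Union>p\<in>I. bad p)"
      using sub finI fin by (intro card_mono) (auto simp: bad_def)
    also have "\<dots> \<le> (\<Sum>p\<in>I. card (bad p))" using finI by (rule card_UN_le)
    also have "\<dots> = card I * ((q - 1) ^ b * q ^ (card E - b))" using cbad by simp
    also have "\<dots> \<le> q * n ^ t * ((q - 1) ^ b * q ^ (card E - b))" using cI by (rule mult_le_mono1)
    finally have "q ^ b \<le> q * n ^ t * (q - 1) ^ b" using q0 by (simp add: mult.assoc[symmetric])
    then show False using less unfolding b_def by simp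
  qed
  then obtain f where f: "f \<in> E \<rightarrow>\<^sub>E {..<q}" "\<And>p. p \<in> I \<Longrightarrow> f \<notin> bad p" by blast
  show ?thesis
  proof (intro bexI ballI)
    show ff: "f \<in> nsets {..<n} k \<rightarrow> {..<q}" using f(1) unfolding E_def by auto
    fix S assume S: "S \<in> nsets {..<n} t"
    have "f ` nsets S k \<subseteq> {..<q}"
      using ff nsets_mono[of S "{..<n}" k] S by (fastforce simp: nsets_def Pi_iff)
    moreover have "i \<in> f ` nsets S k" if "i < q" for i
      using f(2)[of "(S, i)"] f(1) S that unfolding I_def bad_def by auto
    ultimately show "f ` nsets S k = {..<q}" by auto
  qed
qed

text \<open>The number of triples in a \<open>t\<close>-set is cubic in \<open>t\<close>, while the
  exponent in \<open>n ^ t \<le> 2 ^ (t * t)\<close> is quadratic. For \<open>t \<ge> 120\<close>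
  one has t^3 / 27 \<ge> (40 / 9) t^2 \<ge> 4 (3 + t^2).\<close>

lemma not_few_colours_arrow_3:
  "\<forall>\<^sub>F t in sequentially. \<forall>n. real n < 2 powr real t \<longrightarrow> \<not> few_colours_arrow 3 n t 5 5"
proof -
  show ?thesis
    using eventually_ge_at_top[of 120]
  proof eventually_elim
    case (elim t)
    have "120 * real t ^ 2 \<le> real t * real t ^ 2" "120 ^ 2 \<le> real t ^ 2"
      using elim by (intro mult_right_mono power_mono; simp)+
    then have "4 * (3 + real t * real t) \<le> (real t / 3) ^ 3"
      by (simp add: power3_eq_cube power2_eq_square)
    also have "(real t / 3) ^ 3 \<le> real (t choose 3)"
      using binomial_ge_n_over_k_pow_k[of 3 t, where 'a = real] elim by simp
    finally have "real (4 * (3 + t * t)) \<le> real (t choose 3)" by simp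
    then have bb: "4 * (3 + t * t) \<le> t choose 3" by (simp only: of_nat_le_iff)
    show ?case
    proof (intro allI impI)
      fix n :: nat assume "real n < 2 powr real t"
      then have "n < 2 ^ t" by (simp add: powr_realpow) 
      then have "n ^ t \<le> (2 ^ t) ^ t" by (intro power_mono) auto
      also have "(2 ^ t) ^ t = (2::nat) ^ (t * t)" by (simp add: power_mult)
      finally have nt: "n ^ t \<le> 2 ^ (t * t)" .
      define b where "b = t choose 3"
      define d where "d = b - 4 * (3 + t * t)"
      have b: "b = 4 * (3 + t * t) + d" using bb unfolding b_def d_def by simp
      have "0 < (2::nat) ^ (t * t)" by simp
      then have "5 * n ^ t < 8 * 2 ^ (t * t)" using nt by linarith
      also have "8 * 2 ^ (t * t) = (2::nat) ^ (3 + t * t)" by (simp add: power_add)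
      finally have "5 * n ^ t < 2 ^ (3 + t * t)" .
      then have "5 * n ^ t * 4 ^ b < 2 ^ (3 + t * t) * 4 ^ b" by simp
      \<comment> \<open>Each factor 2 is grouped with four triples, because 2 * 4^4 = 512 < 625 =
        5^4.\<close>
      also have "\<dots> = (2 * 4 ^ 4) ^ (3 + t * t) * 4 ^ d"
        unfolding b by (simp only: power_add power_mult power_mult_distrib mult_ac)
      also have "\<dots> \<le> (5 ^ 4) ^ (3 + t * t) * 5 ^ d"
        by (intro mult_le_mono power_mono) auto
      also have "\<dots> = 5 ^ b" unfolding b by (simp only: power_add power_mult)
      finally have "5 * n ^ t * (5 - 1) ^ (t choose 3) < (5::nat) ^ (t choose 3)"
        unfolding b_def by simp
      then obtain f :: "nat set \<Rightarrow> nat" where "f \<in> nsets {..<n} 3 \<rightarrow> {..<5}"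
          "\<And>S. S \<in> nsets {..<n} t \<Longrightarrow> f ` nsets S 3 = {..<5}"
        using exists_colouring_all_colours[of 5 n t 3] by auto
      then show "\<not> few_colours_arrow 3 n t 5 5"
        unfolding not_few_colours_arrow_iff by (intro bexI[of _ f]) simp_all
    qed
  qed
qed

section \<open>The splitting level of two binary expansions\<close>

text \<open>Division by \<open>2 ^ Suc d\<close> deletes the binary positions 0 to \<open>d\<close>.
  The value is 0 also for \<open>u = v\<close>, so later definitions compare only distinct
  words.\<close>

definition split_level :: "nat \<Rightarrow> nat \<Rightarrow> nat" where
  "split_level u v = (LEAST d. u div 2 ^ Suc d = v div 2 ^ Suc d)"

lemma div_pow2_eq_mono:
  fixes u v :: nat
  assumes "u div 2 ^ d = v div 2 ^ d" "d \<le> e"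
  shows "u div 2 ^ e = v div 2 ^ e"
proof -
  have "(2::nat) ^ e = 2 ^ d * 2 ^ (e - d)" using assms(2) by (simp flip: power_add)
  then show ?thesis using assms(1) by (simp add: div_mult2_eq)
qed

lemma split_level_le_iff: "split_level u v \<le> d \<longleftrightarrow> u div 2 ^ Suc d = v div 2 ^ Suc d"
proof
  \<comment> \<open>At \<open>d = u + v\<close> both quotients vanish, so the \<open>LEAST\<close>
    ranges over a nonempty set.\<close>
  have "u + v < 2 ^ (u + v)" by (rule less_exp)
  then have "u < 2 ^ Suc (u + v)" "v < 2 ^ Suc (u + v)" unfolding power_Suc by linarith+
  then have "u div 2 ^ Suc (u + v) = v div 2 ^ Suc (u + v)" by simp
  then have "u div 2 ^ Suc (split_level u v) = v div 2 ^ Suc (split_level u v)"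
    unfolding split_level_def by (rule LeastI)
  then show "u div 2 ^ Suc d = v div 2 ^ Suc d" if "split_level u v \<le> d"
    using that by (intro div_pow2_eq_mono[of u "Suc (split_level u v)" v "Suc d"]) simp_all
qed (auto simp: split_level_def intro: Least_le)

lemma split_level_less:
  assumes "u < 2 ^ m" "v < 2 ^ m" "u \<noteq> v"
  shows "split_level u v < m"
proof -
  obtain m' where m: "m = Suc m'" using assms by (cases m) auto
  show ?thesis using assms unfolding m less_Suc_eq_le split_level_le_iff by simp
qed

text \<open>Truncation is monotone, so if the truncations of \<open>u\<close> and \<open>w\<close>
  agree, that of \<open>v\<close> is squeezed between them.\<close>

lemma split_level_max:
  assumes "u \<le> v" "v \<le> w"
  shows "split_level u w = max (split_level u v) (split_level v w)"
proof -
  have "split_level u w \<le> d \<longleftrightarrow> split_level u v \<le> d \<and> split_level v w \<le> d" for d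
    unfolding split_level_le_iff
    using assms div_le_mono[of u v "2 ^ Suc d"] div_le_mono[of v w "2 ^ Suc d"] by auto
  then show ?thesis by (metis max.bounded_iff order_antisym order_refl)
qed

text \<open>Equal levels would force three different digits in one binary position below a common
  prefix.\<close>

lemma split_level_neq:
  assumes "u < v" "v < w"
  shows "split_level u v \<noteq> split_level v w"
proof
  assume eq: "split_level u v = split_level v w"
  define d where "d = split_level u v"
  have "u div 2 ^ Suc d = v div 2 ^ Suc d" "v div 2 ^ Suc d = w div 2 ^ Suc d"
    unfolding d_def using eq split_level_le_iff by (metis order_refl)+
  moreover have "u div 2 ^ d < v div 2 ^ d"
  proof (cases d)
    case (Suc e)
    then have "u div 2 ^ d \<noteq> v div 2 ^ d" using split_level_le_iff[of u v e] d_def by simp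
    then show ?thesis using div_le_mono[of u v "2 ^ d"] assms by simp
  qed (use assms in simp)
  moreover have "v div 2 ^ d < w div 2 ^ d"
  proof (cases d)
    case (Suc e)
    then have "v div 2 ^ d \<noteq> w div 2 ^ d" using split_level_le_iff[of v w e] d_def eq by simp
    then show ?thesis using div_le_mono[of v w "2 ^ d"] assms by simp
  qed (use assms in simp)
  moreover have "x div 2 ^ Suc d = x div 2 ^ d div 2" for x :: nat
    by (metis div_mult2_eq power_Suc2)
  moreover have False if "a < b" "b < c" "a div 2 = b div 2" "b div 2 = c div 2" for a b c :: nat
    using that by linarith
  ultimately show False by metis
qed

section \<open>Chains and binary trees\<close>

definition inc_chain :: "nat set \<Rightarrow> bool" where
  "inc_chain C \<longleftrightarrow> (\<forall>x\<in>C. \<forall>y\<in>C. \<forall>z\<in>C. x < y \<longrightarrow> y < z \<longrightarrow> split_level x y < split_level y z)"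

definition dec_chain :: "nat set \<Rightarrow> bool" where
  "dec_chain C \<longleftrightarrow> (\<forall>x\<in>C. \<forall>y\<in>C. \<forall>z\<in>C. x < y \<longrightarrow> y < z \<longrightarrow> split_level y z < split_level x y)"

text \<open>For nonempty parts this is a tree node at position \<open>D\<close>: all words agree
  above it, those in \<open>L\<close> have digit 0 there and those in \<open>R\<close> digit
  1.\<close>

definition splits :: "nat \<Rightarrow> nat set \<Rightarrow> nat set \<Rightarrow> bool" where
  "splits D L R \<longleftrightarrow>
     (\<forall>x\<in>L. \<forall>y\<in>R. x < y \<and> split_level x y = D) \<and>
     (\<forall>x\<in>L. \<forall>y\<in>L. x < y \<longrightarrow> split_level x y < D) \<and>
     (\<forall>x\<in>R. \<forall>y\<in>R. x < y \<longrightarrow> split_level x y < D)"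

text \<open>\<open>L\<close> and \<open>R\<close> need not exhaust \<open>S\<close>, so branchings
  of the tree of words may be skipped. Levels of nodes in different branches are not
  compared.\<close>

fun has_tree :: "nat \<Rightarrow> nat set \<Rightarrow> bool" where
  "has_tree 0 S \<longleftrightarrow> S \<noteq> {}"
| "has_tree (Suc r) S \<longleftrightarrow>
     (\<exists>D L R. L \<subseteq> S \<and> R \<subseteq> S \<and> splits D L R \<and> has_tree r L \<and> has_tree r R)"

lemma exists_splits:
  assumes "finite S" "card S \<ge> 2"
  shows "\<exists>D L R. S = L \<union> R \<and> L \<noteq> {} \<and> R \<noteq> {} \<and> splits D L R"
proof -
  define m where "m = Min S"
  define M where "M = Max S"
  have ne: "S \<noteq> {}" using assms by auto
  have mM: "m \<in> S" "M \<in> S" "\<And>x. x \<in> S \<Longrightarrow> m \<le> x" "\<And>x. x \<in> S \<Longrightarrow> x \<le> M"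
    unfolding m_def M_def using assms ne by auto
  have "m \<noteq> M"
  proof
    assume "m = M"
    then have "S \<subseteq> {m}" using mM by force
    then show False using assms card_mono[of "{m}" S] by simp
  qed
  then have "m < M" using mM by force
  define D where "D = split_level m M"
  \<comment> \<open>\<open>L\<close> collects the words that agree with the minimum at the top
    position \<open>D\<close>. The minimum is treated apart because
    \<open>split_level m m = 0\<close> may equal \<open>D\<close>.\<close>
  define L where "L = {x \<in> S. x = m \<or> split_level m x < D}"
  define R where "R = {x \<in> S. x \<noteq> m \<and> split_level m x = D}"
  have le: "split_level m x \<le> D" if "x \<in> S" for x
    using split_level_max[of m x M] mM that unfolding D_def by simp
  have 1: "x < y \<and> split_level x y = D" if "x \<in> L" "y \<in> R" for x y
  proof -
    have y: "y \<in> S" "m < y" "split_level m y = D" using that(2) mM(3) unfolding R_def by force+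
    show ?thesis
    proof (cases "x = m")
      case False
      then have x: "x \<in> S" "split_level m x < D" "m < x" using that(1) mM(3) unfolding L_def by force+
      have "x < y"
      proof (rule ccontr)
        assume "\<not> x < y"
        then show False using split_level_max[of m y x] y x by simp
      qed
      then show ?thesis using split_level_max[of m x y] x y by simp
    qed (use y in simp)
  qed
  have 2: "split_level x y < D" if "x \<in> L" "y \<in> L" "x < y" for x y
  proof -
    have "m \<le> x" "y \<noteq> m" "split_level m y < D" using that mM(3) unfolding L_def by force+
    then show ?thesis using split_level_max[of m x y] that by simp
  qed
  have 3: "split_level x y < D" if "x \<in> R" "y \<in> R" "x < y" for x y
  proof -
    have x: "m < x" "split_level m x = D" "split_level m y = D" using that mM(3) unfolding R_def by force+
    then show ?thesis using split_level_max[of m x y] split_level_neq[of m x y] that by simp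
  qed
  have "m \<in> L" "M \<in> R" "S = L \<union> R"
    using mM \<open>m < M\<close> le unfolding L_def R_def by (auto simp: D_def[symmetric] order.order_iff_strict)
  moreover have "splits D L R"
    unfolding splits_def using 1 2 3 by simp
  ultimately show ?thesis by blast
qed

lemma splits_empty_Int: "splits D L R \<Longrightarrow> L \<inter> R = {}"
  unfolding splits_def by blast

lemma inc_chain_insert:
  assumes "splits D L R" "C \<subseteq> L" "inc_chain C" "y \<in> R"
  shows "inc_chain (insert y C)"
proof -
  have *: "x < y" "split_level x y = D" if "x \<in> C" for x
    using assms that unfolding splits_def by blast+
  have **: "split_level x z < D" if "x \<in> C" "z \<in> C" "x < z" for x z
    using assms that unfolding splits_def by blast
  show ?thesis
    using assms(3) * ** unfolding inc_chain_def by (metis insert_iff less_asym less_irrefl)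
qed

lemma dec_chain_insert:
  assumes "splits D L R" "C \<subseteq> R" "dec_chain C" "y \<in> L"
  shows "dec_chain (insert y C)"
proof -
  have *: "y < x" "split_level y x = D" if "x \<in> C" for x
    using assms that unfolding splits_def by blast+
  have **: "split_level x z < D" if "x \<in> C" "z \<in> C" "x < z" for x z
    using assms that unfolding splits_def by blast
  show ?thesis
    using assms(3) * ** unfolding dec_chain_def by (metis insert_iff less_asym less_irrefl)
qed

lemma has_tree_mono: "has_tree r S \<Longrightarrow> S \<subseteq> S' \<Longrightarrow> has_tree r S'"
  by (cases r) (auto, meson order_trans)

text \<open>
  An increasing chain inside the left part extends to the right part and a decreasing chain inside
  the right part extends to the left part, so \<open>a + b\<close> drops on both sides, while at most one side
  can keep a tree of depth \<open>r\<close>.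
\<close>

lemma chain_or_tree:
  assumes "finite S" "(a + b) ^ r < card S"
  shows "(\<exists>C\<subseteq>S. card C = a \<and> inc_chain C) \<or> (\<exists>C\<subseteq>S. card C = b \<and> dec_chain C) \<or> has_tree r S"
  using assms
proof (induction "card S" arbitrary: S a b r rule: less_induct)
  case less
  show ?case
  proof (rule ccontr)
    assume "\<not> ?case"
    then have no_inc: "\<And>C. C \<subseteq> S \<Longrightarrow> card C = a \<Longrightarrow> \<not> inc_chain C"
      and no_dec: "\<And>C. C \<subseteq> S \<Longrightarrow> card C = b \<Longrightarrow> \<not> dec_chain C"
      and no_tree: "\<not> has_tree r S" by blast+
    have "a \<noteq> 0" "b \<noteq> 0"
      using no_inc[of "{}"] no_dec[of "{}"] by (auto simp: inc_chain_def dec_chain_def)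
    then obtain a' b' where ab: "a = Suc a'" "b = Suc b'" by (metis not0_implies_Suc)
    have "S \<noteq> {}" using less.prems by auto
    with no_tree obtain r' where r: "r = Suc r'" by (cases r) auto
    define m where "m = a' + b' + 1"
    have m: "a + b = Suc m" "a' + b = m" "a + b' = m" unfolding m_def ab by auto
    have "1 \<le> (a + b) ^ r" using m by simp
    then have "card S \<ge> 2" using less.prems by linarith
    then obtain D L R where S: "S = L \<union> R" "L \<noteq> {}" "R \<noteq> {}" "splits D L R"
      using exists_splits less.prems by metis
    have fin: "finite L" "finite R" using S less.prems by auto
    have cS: "card S = card L + card R"
      using splits_empty_Int[OF S(4)] fin S(1) by (simp add: card_Un_disjoint)
    have lt: "card L < card S" "card R < card S" using cS S fin by (auto simp: card_gt_0_iff)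
    have L1: "\<not> (\<exists>C\<subseteq>L. card C = a' \<and> inc_chain C)"
    proof
      assume "\<exists>C\<subseteq>L. card C = a' \<and> inc_chain C"
      then obtain C y where C: "C \<subseteq> L" "card C = a'" "inc_chain C" "y \<in> R" using S by blast
      have "y \<notin> C" using C splits_empty_Int[OF S(4)] by blast
      have "finite C" using C(1) fin(1) by (rule finite_subset)
      then have "card (insert y C) = a" using \<open>y \<notin> C\<close> C(2) ab by simp
      moreover have "insert y C \<subseteq> S" using C S(1) by blast
      ultimately show False using inc_chain_insert[OF S(4) C(1,3,4)] no_inc by blast
    qed
    have R1: "\<not> (\<exists>C\<subseteq>R. card C = b' \<and> dec_chain C)"
    proof
      assume "\<exists>C\<subseteq>R. card C = b' \<and> dec_chain C"
      then obtain C y where C: "C \<subseteq> R" "card C = b'" "dec_chain C" "y \<in> L" using S by blast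
      have "y \<notin> C" using C splits_empty_Int[OF S(4)] by blast
      have "finite C" using C(1) fin(2) by (rule finite_subset)
      then have "card (insert y C) = b" using \<open>y \<notin> C\<close> C(2) ab by simp
      moreover have "insert y C \<subseteq> S" using C S(1) by blast
      ultimately show False using dec_chain_insert[OF S(4) C(1,3,4)] no_dec by blast
    qed
    have L2: "\<not> (\<exists>C\<subseteq>L. card C = b \<and> dec_chain C)" and R2: "\<not> (\<exists>C\<subseteq>R. card C = a \<and> inc_chain C)"
      using no_dec no_inc S(1) by blast+
    have L3: "card L \<le> m ^ j" if "\<not> has_tree j L" for j
      using less.hyps[OF lt(1) fin(1), of a' b j] L1 L2 that unfolding m by (meson not_le)
    have R3: "card R \<le> m ^ j" if "\<not> has_tree j R" for j
      using less.hyps[OF lt(2) fin(2), of a b' j] R1 R2 that unfolding m by (meson not_le)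
    have "\<not> has_tree r L" "\<not> has_tree r R" using no_tree has_tree_mono S(1) by blast+
    note LR = L3[OF this(1)] R3[OF this(2)]
    have "\<not> has_tree r' L \<or> \<not> has_tree r' R"
      using no_tree S(1,4) unfolding r by auto
    then have "card L \<le> m ^ r' \<or> card R \<le> m ^ r'" using L3 R3 by blast
    \<comment> \<open>One side has no tree of depth \<open>r'\<close> and the other none of depth
      \<open>r\<close>. The two bounds add up to (m + 1) m^r' \<le> (m + 1)^r.\<close>
    then have "card S \<le> m ^ r + m ^ r'" using LR cS by linarith
    also have "\<dots> = Suc m * m ^ r'" unfolding r by simp
    also have "\<dots> \<le> Suc m * Suc m ^ r'" by (intro mult_le_mono2 power_mono) auto
    finally show False using less.prems unfolding m r by simp
  qed
qed

text \<open>This supplies the vertices that pad four chosen words to a full edge; a linear bound is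
  enough for that.\<close>

lemma card_ge_of_has_tree: "has_tree r S \<Longrightarrow> finite S \<Longrightarrow> r < card S"
proof (induction r arbitrary: S)
  case (Suc r)
  then obtain D L R where LR: "L \<subseteq> S" "R \<subseteq> S" "splits D L R" "has_tree r L" "has_tree r R"
    by auto
  have fin: "finite L" "finite R" using LR Suc.prems finite_subset by blast+
  have "card L + card R = card (L \<union> R)"
    using splits_empty_Int[OF LR(3)] fin by (simp add: card_Un_disjoint)
  also have "\<dots> \<le> card S" using LR Suc.prems by (intro card_mono) auto
  finally show ?case using Suc.IH[OF LR(4) fin(1)] Suc.IH[OF LR(5) fin(2)] by simp
qed (auto simp: card_gt_0_iff)

section \<open>Stepping up\<close>

text \<open>Values 0 to 3 are the patterns 123, 321, 213, 312. For levels of four increasing words,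
  neighbours differ by \<open>split_level_neq\<close>, and a valley cannot have equal ends, by
  \<open>split_level_max\<close> and \<open>split_level_neq\<close>; so 4 means exactly a peak in
  the middle.\<close>

definition shape :: "nat \<Rightarrow> nat \<Rightarrow> nat \<Rightarrow> nat" where
  "shape x y z =
     (if x < y \<and> y < z then 0 else if x > y \<and> y > z then 1
      else if x > y \<and> y < z \<and> x < z then 2 else if x > y \<and> y < z \<and> x > z then 3 else 4)"

definition list_shape :: "nat list \<Rightarrow> nat" where
  "list_shape xs = shape (split_level (xs ! 0) (xs ! 1)) (split_level (xs ! 1) (xs ! 2))
     (split_level (xs ! 2) (xs ! 3))"

text \<open>
  For an increasing or decreasing chain these are just the levels of consecutive elements, so that
  the chain has one more element than levels.
\<close>

definition split_levels :: "nat set \<Rightarrow> nat set" where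
  "split_levels X = {split_level x y | x y. x \<in> X \<and> y \<in> X \<and> x < y}"

text \<open>A pair coded as one number: \<open>mod 5\<close> gives the pattern and
  \<open>div 5\<close> the old colour. By \<open>split_level_max\<close> the set
  \<open>split_levels X\<close> consists of the consecutive levels; if these repeat, it is no
  \<open>k\<close>-edge and the old colour defaults to 0.\<close>

definition step_up :: "nat \<Rightarrow> nat \<Rightarrow> (nat set \<Rightarrow> nat) \<Rightarrow> nat set \<Rightarrow> nat" where
  "step_up k m f X = list_shape (sorted_list_of_set X) +
     5 * (if split_levels X \<in> nsets {..<m} k then f (split_levels X) else 0)"

lemma list_shape_less: "list_shape xs < 5"
  unfolding list_shape_def shape_def by simp

text \<open>Depth 3 gives a root \<open>D\<close>, a node below it on each side (\<open>Da\<close>,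
  \<open>Db\<close>), and a pair of words below each branch of these. Patterns 0 and 2 use one word
  from the right half, 1 and 3 one word from the left half.\<close>

lemma has_tree_shapes:
  assumes "has_tree 3 S" "i < 5"
  shows "\<exists>x\<in>S. \<exists>y\<in>S. \<exists>z\<in>S. \<exists>w\<in>S. x < y \<and> y < z \<and> z < w \<and>
     shape (split_level x y) (split_level y z) (split_level z w) = i"
proof -
  have node: "\<exists>D L R. L \<subseteq> T \<and> R \<subseteq> T \<and> splits D L R \<and> has_tree r L \<and> has_tree r R"
    if "has_tree (Suc r) T" for r T using that by simp
  have num: "3 = Suc 2" "2 = Suc 1" by simp_all
  obtain D A B where AB: "A \<subseteq> S" "B \<subseteq> S" "splits D A B" "has_tree 2 A" "has_tree 2 B"
    using node[OF assms(1)[unfolded num(1)]] by blast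
  obtain Da A1 A2 where A: "A1 \<subseteq> A" "A2 \<subseteq> A" "splits Da A1 A2" "has_tree 1 A1" "has_tree 1 A2"
    using node[OF AB(4)[unfolded num(2)]] by blast
  obtain Db B1 B2 where B: "B1 \<subseteq> B" "B2 \<subseteq> B" "splits Db B1 B2" "has_tree 1 B1" "has_tree 1 B2"
    using node[OF AB(5)[unfolded num(2)]] by blast
  have leaf: "\<exists>u\<in>T. \<exists>v\<in>T. u < v" if "has_tree 1 T" for T
    using that by (fastforce simp: splits_def)
  obtain a1 a2 where a: "a1 \<in> A1" "a2 \<in> A1" "a1 < a2" using leaf[OF A(4)] by blast
  obtain a3 a4 where a': "a3 \<in> A2" "a4 \<in> A2" "a3 < a4" using leaf[OF A(5)] by blast
  obtain b1 b2 where b: "b1 \<in> B1" "b2 \<in> B1" "b1 < b2" using leaf[OF B(4)] by blast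
  obtain b3 b4 where b': "b3 \<in> B2" "b4 \<in> B2" "b3 < b4" using leaf[OF B(5)] by blast
  have inA: "a1 \<in> A" "a2 \<in> A" "a3 \<in> A" "a4 \<in> A" using a a' A by blast+
  have inB: "b1 \<in> B" "b2 \<in> B" "b3 \<in> B" "b4 \<in> B" using b b' B by blast+
  have inS: "a1 \<in> S" "a2 \<in> S" "a3 \<in> S" "a4 \<in> S" "b1 \<in> S" "b2 \<in> S" "b3 \<in> S" "b4 \<in> S"
    using inA inB AB by blast+
  have a23: "split_level a1 a2 < Da" "split_level a3 a4 < Da" "split_level a2 a3 = Da"
      "a2 < a3"
    using A(3) a a' unfolding splits_def by blast+
  have b23: "split_level b1 b2 < Db" "split_level b3 b4 < Db" "split_level b2 b3 = Db" "b2 < b3"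
      "b1 < b3" "split_level b1 b3 = Db"
    using B(3) b b' unfolding splits_def by blast+
  have cross: "x < y" "split_level x y = D" if "x \<in> A" "y \<in> B" for x y
    using AB(3) that unfolding splits_def by blast+
  have DaD: "Da < D" using AB(3) inA a23 unfolding splits_def by blast
  have DbD: "Db < D" using AB(3) inB b23 unfolding splits_def by blast
  have ex: ?thesis if "x \<in> S" "y \<in> S" "z \<in> S" "w \<in> S" "x < y" "y < z" "z < w"
     "shape (split_level x y) (split_level y z) (split_level z w) = i" for x y z w
    using that by blast
  note facts = inS inA inB DaD DbD a a' b b' a23 b23 cross
  consider "i = 0" | "i = 1" | "i = 2" | "i = 3" | "i = 4" using assms(2) by linarith
  then show ?thesis
  proof cases
    case 1
    show ?thesis by (rule ex[of a1 a2 a3 b1]) (use 1 facts in \<open>simp_all add: shape_def\<close>)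
  next
    case 2
    show ?thesis by (rule ex[of a1 b1 b3 b4]) (use 2 facts in \<open>simp_all add: shape_def\<close>)
  next
    case 3
    show ?thesis by (rule ex[of a2 a3 a4 b1]) (use 3 facts in \<open>simp_all add: shape_def\<close>)
  next
    case 4
    show ?thesis by (rule ex[of a1 b1 b2 b3]) (use 4 facts in \<open>simp_all add: shape_def\<close>)
  next
    case 5
    \<comment> \<open>Both outer levels lie below \<open>D\<close>, in unknown order, so only the
      peak itself is certain.\<close>
    show ?thesis by (rule ex[of a1 a2 b1 b2]) (use 5 facts in \<open>simp_all add: shape_def\<close>)
  qed
qed

lemma has_tree_le:
  assumes "has_tree r S" "r' \<le> r"
  shows "has_tree r' S"
proof -
  have step: "has_tree r S" if "has_tree (Suc r) S" for r S
    using that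
  proof (induction r arbitrary: S)
    case (Suc r)
    then obtain D L R where LR: "L \<subseteq> S" "R \<subseteq> S" "splits D L R"
        "has_tree (Suc r) L" "has_tree (Suc r) R"
      by (auto simp del: has_tree.simps(2) simp: has_tree.simps(2)[of "Suc r"])
    then show ?case using Suc.IH[OF LR(4)] Suc.IH[OF LR(5)] by auto
  qed auto
  show ?thesis using assms(2,1) by (induction rule: inc_induct) (use step in blast)+
qed

text \<open>Padding an edge by larger vertices leaves its pattern unchanged.\<close>

lemma list_shape_sorted_list_of_set:
  assumes "x < y" "y < z" "z < w" "finite W" "\<And>v. v \<in> W \<Longrightarrow> w < v"
  shows "list_shape (sorted_list_of_set ({x, y, z, w} \<union> W)) =
    shape (split_level x y) (split_level y z) (split_level z w)"
proof -
  define xs where "xs = x # y # z # w # sorted_list_of_set W"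
  have "sorted xs" "distinct xs" "set xs = {x, y, z, w} \<union> W"
    unfolding xs_def using assms by (force simp: less_imp_le)+
  then have "sorted_list_of_set ({x, y, z, w} \<union> W) = xs"
    by (metis sorted_list_of_set.idem_if_sorted_distinct)
  then show ?thesis by (simp add: list_shape_def xs_def numeral_2_eq_2 numeral_3_eq_3)
qed

text \<open>In an increasing chain the level of a pair depends only on its larger element. Hence
  \<open>split_level m\<close>, with \<open>m\<close> the minimum, matches the other elements with
  the levels, and edges through \<open>m\<close> with sets of levels.\<close>

lemma split_levels_inc_chain:
  assumes "inc_chain C" "m \<in> C" "\<And>x. x \<in> C \<Longrightarrow> m \<le> x"
  shows "inj_on (split_level m) (C - {m})"
    and "Y \<subseteq> C - {m} \<Longrightarrow> split_levels (insert m Y) = split_level m ` Y"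
proof -
  have eq: "split_level x y = split_level m y" if "x \<in> C" "y \<in> C" "x < y" for x y
  proof (cases "x = m")
    case False
    then have "m < x" using assms(3) that by force
    then have "split_level m x < split_level x y"
      using assms(1,2) that unfolding inc_chain_def by blast
    then show ?thesis using split_level_max[of m x y] \<open>m < x\<close> that by simp
  qed simp
  show "inj_on (split_level m) (C - {m})"
  proof (rule linorder_inj_onI')
    fix x y assume xy: "x \<in> C - {m}" "y \<in> C - {m}" "x < y"
    then have "m < x" using assms(3) by force
    then have "split_level m x < split_level x y"
      using assms(1,2) xy unfolding inc_chain_def by blast
    then show "split_level m x \<noteq> split_level m y" using eq[of x y] xy by simp
  qed
  show "split_levels (insert m Y) = split_level m ` Y" if "Y \<subseteq> C - {m}"
  proof
    show "split_levels (insert m Y) \<subseteq> split_level m ` Y"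
    proof
      fix d assume "d \<in> split_levels (insert m Y)"
      then obtain x y where xy: "d = split_level x y" "x \<in> insert m Y" "y \<in> insert m Y" "x < y"
        unfolding split_levels_def by blast
      have C: "x \<in> C" "y \<in> C" using xy that assms(2) by blast+
      then have "m \<le> x" using assms(3) by blast
      then have "y \<in> Y" using xy by auto
      then show "d \<in> split_level m ` Y" using eq[OF C xy(4)] xy(1) by blast
    qed
    show "split_level m ` Y \<subseteq> split_levels (insert m Y)"
    proof
      fix d assume "d \<in> split_level m ` Y"
      then obtain y where y: "d = split_level m y" "y \<in> Y" by blast
      then have "m < y" using assms(3)[of y] that by (auto simp: nat_less_le)
      then show "d \<in> split_levels (insert m Y)" using y unfolding split_levels_def by blast
    qed
  qed
qed

text \<open>The mirror image: the smaller element decides the level, and \<open>m\<close> is the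
  maximum.\<close>

lemma split_levels_dec_chain:
  assumes "dec_chain C" "m \<in> C" "\<And>x. x \<in> C \<Longrightarrow> x \<le> m"
  shows "inj_on (\<lambda>x. split_level x m) (C - {m})"
    and "Y \<subseteq> C - {m} \<Longrightarrow> split_levels (insert m Y) = (\<lambda>x. split_level x m) ` Y"
proof -
  have eq: "split_level x y = split_level x m" if "x \<in> C" "y \<in> C" "x < y" for x y
  proof (cases "y = m")
    case False
    then have "y < m" using assms(3) that by force
    then have "split_level y m < split_level x y"
      using assms(1,2) that unfolding dec_chain_def by blast
    then show ?thesis using split_level_max[of x y m] \<open>y < m\<close> that by simp
  qed simp
  show "inj_on (\<lambda>x. split_level x m) (C - {m})"
  proof (rule linorder_inj_onI')
    fix x y assume xy: "x \<in> C - {m}" "y \<in> C - {m}" "x < y"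
    then have "y < m" using assms(3) by force
    then have "split_level y m < split_level x y"
      using assms(1,2) xy unfolding dec_chain_def by blast
    then show "split_level x m \<noteq> split_level y m" using eq[of x y] xy by simp
  qed
  show "split_levels (insert m Y) = (\<lambda>x. split_level x m) ` Y" if "Y \<subseteq> C - {m}"
  proof
    show "split_levels (insert m Y) \<subseteq> (\<lambda>x. split_level x m) ` Y"
    proof
      fix d assume "d \<in> split_levels (insert m Y)"
      then obtain x y where xy: "d = split_level x y" "x \<in> insert m Y" "y \<in> insert m Y" "x < y"
        unfolding split_levels_def by blast
      have C: "x \<in> C" "y \<in> C" using xy that assms(2) by blast+
      then have "y \<le> m" using assms(3) by blast
      then have "x \<in> Y" using xy by auto
      then show "d \<in> (\<lambda>x. split_level x m) ` Y" using eq[OF C xy(4)] xy(1) by blast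
    qed
    show "(\<lambda>x. split_level x m) ` Y \<subseteq> split_levels (insert m Y)"
    proof
      fix d assume "d \<in> (\<lambda>x. split_level x m) ` Y"
      then obtain y where y: "d = split_level y m" "y \<in> Y" by blast
      then have "y < m" using assms(3)[of y] that by (auto simp: nat_less_le)
      then show "d \<in> split_levels (insert m Y)" using y unfolding split_levels_def by blast
    qed
  qed
qed

text \<open>Common to both kinds of chain, with \<open>e\<close> the matching of elements and
  levels. The \<open>s\<close> levels form a set \<open>E\<close> of old vertices; each
  \<open>k\<close>-subset of \<open>E\<close> pulls back to an edge through \<open>m\<close>, whose
  new colour reveals the old one by \<open>div 5\<close>.\<close>

lemma card_step_up_chain:
  assumes C: "C \<subseteq> {..<2 ^ M}" "card C = Suc s" "m \<in> C"
    and inj: "inj_on e (C - {m})"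
    and e: "\<And>Y. Y \<subseteq> C - {m} \<Longrightarrow> split_levels (insert m Y) = e ` Y"
    and f: "\<And>E. E \<in> nsets {..<M} s \<Longrightarrow> p \<le> card (f ` nsets E k)"
  shows "p \<le> card (step_up k M f ` nsets C (Suc k))"
proof -
  have finC: "finite C" using C(1) finite_subset by blast
  define E where "E = e ` (C - {m})"
  have "E = split_levels C" unfolding E_def using e[of "C - {m}"] C(3) by (simp add: insert_absorb)
  then have EM: "E \<subseteq> {..<M}"
    using C(1) unfolding split_levels_def by (auto intro!: split_level_less)
  have "card E = s" unfolding E_def using inj C finC by (simp add: card_image)
  with EM have "E \<in> nsets {..<M} s" by (auto simp: nsets_def finite_subset)
  then have "p \<le> card (f ` nsets E k)" by (rule f)
  also have "\<dots> \<le> card ((\<lambda>c. c div 5) ` step_up k M f ` nsets C (Suc k))"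
  proof (rule card_mono)
    show "finite ((\<lambda>c. c div 5) ` step_up k M f ` nsets C (Suc k))"
      using finC by (simp add: finite_imp_finite_nsets)
    show "f ` nsets E k \<subseteq> (\<lambda>c. c div 5) ` step_up k M f ` nsets C (Suc k)"
    proof (rule image_subsetI)
      fix Z assume Z: "Z \<in> nsets E k"
      then have "Z \<subseteq> e ` (C - {m})" unfolding E_def nsets_def by blast
      then obtain Y where Y: "Y \<subseteq> C - {m}" "inj_on e Y" "Z = e ` Y"
        by (auto simp: subset_image_inj)
      have finY: "finite Y" using Y(1) finC finite_subset by blast
      have "card Y = k" using Z card_image[OF Y(2)] Y(3) by (simp add: nsets_def)
      moreover have "m \<notin> Y" using Y(1) by blast
      ultimately have X: "insert m Y \<in> nsets C (Suc k)"
        using Y(1) C(3) finY by (auto simp: nsets_def)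
      have "Z \<in> nsets {..<M} k" using Z EM nsets_mono by blast
      then have "step_up k M f (insert m Y) div 5 = f Z"
        unfolding step_up_def e[OF Y(1)] Y(3)[symmetric] using list_shape_less by simp
      then show "f Z \<in> (\<lambda>c. c div 5) ` step_up k M f ` nsets C (Suc k)"
        using X by (metis image_eqI)
    qed
  qed
  also have "\<dots> \<le> card (step_up k M f ` nsets C (Suc k))"
    using finC by (intro card_image_le) (simp add: finite_imp_finite_nsets)
  finally show ?thesis .
qed

text \<open>The left half, of depth \<open>k \<ge> 3\<close>, realises every pattern on four words;
  the right half adds \<open>k - 3\<close> larger ones. The pattern is read off by
  \<open>mod 5\<close>.\<close>

lemma card_step_up_tree:
  assumes "has_tree (Suc k) S" "finite S" "k \<ge> 3"
  shows "5 \<le> card (step_up k M f ` nsets S (Suc k))"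
proof -
  obtain D L R where LR: "L \<subseteq> S" "R \<subseteq> S" "splits D L R" "has_tree k L" "has_tree k R"
    using assms(1) by auto
  have "finite R" using LR(2) assms(2) finite_subset by blast
  then have "k - 3 \<le> card R" using card_ge_of_has_tree[OF LR(5)] by simp
  then obtain W where W: "W \<subseteq> R" "card W = k - 3" "finite W" by (rule obtain_subset_with_card_n)
  have "{..<5} \<subseteq> (\<lambda>c. c mod 5) ` step_up k M f ` nsets S (Suc k)"
  proof
    fix i :: nat assume "i \<in> {..<5}"
    then obtain x y z w where xyzw: "x \<in> L" "y \<in> L" "z \<in> L" "w \<in> L" "x < y" "y < z" "z < w"
      and i: "shape (split_level x y) (split_level y z) (split_level z w) = i"
      using has_tree_shapes[OF has_tree_le[OF LR(4) assms(3)], of i] by auto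
    have less: "v < u" if "v \<in> L" "u \<in> W" for u v
      using LR(3) W(1) that unfolding splits_def by blast
    define X where "X = {x, y, z, w} \<union> W"
    have "{x, y, z, w} \<inter> W = {}" using less xyzw by fastforce
    then have "card X = 4 + (k - 3)"
      unfolding X_def using W xyzw by (simp add: card_Un_disjoint)
    then have "X \<in> nsets S (Suc k)"
      using assms(3) xyzw W LR unfolding X_def nsets_def by auto
    moreover have "list_shape (sorted_list_of_set X) = i"
      unfolding X_def using list_shape_sorted_list_of_set[of x y z w W] xyzw less W(3) i by simp
    then have "step_up k M f X mod 5 = i"
      unfolding step_up_def using \<open>i \<in> {..<5}\<close> by simp
    ultimately show "i \<in> (\<lambda>c. c mod 5) ` step_up k M f ` nsets S (Suc k)"
      by (metis image_eqI)
  qed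
  then have "card {..<5::nat} \<le> card ((\<lambda>c. c mod 5) ` step_up k M f ` nsets S (Suc k))"
    using assms(2) by (intro card_mono) (simp_all add: finite_imp_finite_nsets)
  also have "\<dots> \<le> card (step_up k M f ` nsets S (Suc k))"
    using assms(2) by (intro card_image_le) (simp add: finite_imp_finite_nsets)
  finally show ?thesis by simp
qed

lemma not_few_colours_arrow_Suc:
  assumes "k \<ge> 3" "q > 0" "\<not> few_colours_arrow k M s q 5" "n \<le> 2 ^ M" "(2 * s + 2) ^ Suc k < t"
  shows "\<not> few_colours_arrow (Suc k) n t (5 * q) 5"
proof -
  obtain f where f: "f \<in> nsets {..<M} k \<rightarrow> {..<q}"
      "\<And>E. E \<in> nsets {..<M} s \<Longrightarrow> 5 \<le> card (f ` nsets E k)"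
    using assms(3) unfolding not_few_colours_arrow_iff by blast
  have "step_up k M f X < 5 * q" for X
  proof (cases "split_levels X \<in> nsets {..<M} k")
    case True
    then have "f (split_levels X) < q" using f(1) by auto
    then show ?thesis
      unfolding step_up_def using True list_shape_less[of "sorted_list_of_set X"] by simp
  qed (use list_shape_less[of "sorted_list_of_set X"] assms(2) in \<open>simp add: step_up_def\<close>)
  moreover have "5 \<le> card (step_up k M f ` nsets S (Suc k))" if S: "S \<in> nsets {..<n} t" for S
  proof -
    have finS: "finite S" "card S = t" "S \<subseteq> {..<2 ^ M}"
      using S assms(4) by (auto simp: nsets_def)
    have mono: "5 \<le> card (step_up k M f ` nsets S (Suc k))"
      if "C \<subseteq> S" "5 \<le> card (step_up k M f ` nsets C (Suc k))" for C
    proof -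
      have "card (step_up k M f ` nsets C (Suc k)) \<le> card (step_up k M f ` nsets S (Suc k))"
        using finS(1) nsets_mono[OF that(1)]
        by (intro card_mono image_mono) (simp_all add: finite_imp_finite_nsets)
      then show ?thesis using that(2) by simp
    qed
    \<comment> \<open>Chains of \<open>Suc s\<close> words are sought because they have
      \<open>s\<close> levels.\<close>
    have "(Suc s + Suc s) ^ Suc k < card S" using assms(5) finS(2) by (simp add: mult_2)
    from chain_or_tree[OF finS(1) this]
    consider C where "C \<subseteq> S" "card C = Suc s" "inc_chain C"
      | C where "C \<subseteq> S" "card C = Suc s" "dec_chain C" | "has_tree (Suc k) S"
      by blast
    then show ?thesis
    proof cases
      case (1 C)
      have C: "C \<subseteq> {..<2 ^ M}" "finite C" "C \<noteq> {}" using 1 finS finite_subset by auto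
      then have m: "Min C \<in> C" "\<And>x. x \<in> C \<Longrightarrow> Min C \<le> x" by auto
      show ?thesis
        by (rule mono[OF 1(1) card_step_up_chain[OF C(1) 1(2) m(1)]])
          (use split_levels_inc_chain[OF 1(3) m] f(2) in auto)
    next
      case (2 C)
      have C: "C \<subseteq> {..<2 ^ M}" "finite C" "C \<noteq> {}" using 2 finS finite_subset by auto
      then have m: "Max C \<in> C" "\<And>x. x \<in> C \<Longrightarrow> x \<le> Max C" by auto
      show ?thesis
        by (rule mono[OF 2(1) card_step_up_chain[OF C(1) 2(2) m(1)]])
          (use split_levels_dec_chain[OF 2(3) m] f(2) in auto)
    next
      case 3
      then show ?thesis using card_step_up_tree finS(1) assms(1) by blast
    qed
  qed
  ultimately show ?thesis
    unfolding not_few_colours_arrow_iff by (intro bexI[of _ "step_up k M f"]) auto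
qed

section \<open>Growth\<close>

lemma tower_nonneg: "0 \<le> x \<Longrightarrow> 0 \<le> tower n x"
  by (induction n x rule: tower.induct) auto

lemma tower_mono: "x \<le> y \<Longrightarrow> tower n x \<le> tower n y"
  by (induction n x rule: tower.induct) auto

text \<open>Absorbs the rounding of a tower to an integer: 2^a + 1 \<le> 2^(a + 1) for a \<ge>
  0.\<close>

lemma tower_add_one: "0 \<le> x \<Longrightarrow> tower n x + 1 \<le> tower n (x + 1)"
proof (induction n x rule: tower.induct)
  case (3 i x)
  have "1 \<le> 2 powr tower (Suc i) x"
    using tower_nonneg[OF 3(2)] by (intro ge_one_powr_ge_zero) auto
  then have "2 powr tower (Suc i) x + 1 \<le> 2 powr (tower (Suc i) x + 1)"
    by (simp add: powr_add)
  also have "\<dots> \<le> 2 powr tower (Suc i) (x + 1)" using 3 by (intro powr_mono) auto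
  finally show ?case by simp
qed auto

lemma eventually_root_ge:
  assumes "r > 0"
  shows "\<forall>\<^sub>F t in sequentially. B \<le> real t powr (1 / r)"
  using eventually_ge_at_top[of "nat \<lceil>\<bar>B\<bar> powr r\<rceil>"]
proof eventually_elim
  case (elim t)
  then have "\<bar>B\<bar> powr r \<le> real t" by linarith
  then have "(\<bar>B\<bar> powr r) powr (1 / r) \<le> real t powr (1 / r)"
    using assms by (intro powr_mono2) auto
  then show ?case using assms by (simp add: powr_powr)
qed

text \<open>Take \<open>s\<close> as the integer part of x = t^(1/(k + 2)), so that (2s + 2)^(k + 1)
  \<le> (3x)^(k + 1) < x^(k + 2) = t. Halving the exponent leaves room for rounding both
  \<open>s\<close> and the number \<open>M\<close> of old vertices.\<close>

lemma lower_bound_Suc: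
  fixes c :: real
  assumes "k \<ge> 3" "q \<ge> 5" "c > 0"
    and bound: "\<forall>\<^sub>F t in sequentially. \<forall>n. real n < tower j (real t powr c) \<longrightarrow>
      \<not> few_colours_arrow k n t q 5"
  shows "\<forall>\<^sub>F t in sequentially. \<forall>n. real n < 2 powr tower j (real t powr (c / (2 * (k + 2)))) \<longrightarrow>
    \<not> few_colours_arrow (Suc k) n t (5 * q) 5"
proof -
  obtain T where T: "\<And>t n. t \<ge> T \<Longrightarrow> real n < tower j (real t powr c) \<Longrightarrow>
      \<not> few_colours_arrow k n t q 5"
    using bound unfolding eventually_sequentially by blast
  define r where "r = real (k + 2)"
  have r: "r > 0" unfolding r_def by simp
  \<comment> \<open>Chosen so that \<open>x \<ge> B\<close> gives
    \<open>y \<ge> 2 * 2 powr c\<close>, whence y + 1 \<le> y^2 / 2^c = (x / 2)^c \<le> s^c.\<close>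
  define B where "B = (2 * 2 powr c) powr (2 / c)"
  show ?thesis
    using eventually_root_ge[OF r, of "real T + 1"] eventually_root_ge[OF r, of 2]
      eventually_root_ge[OF r, of "3 ^ Suc k + 1"] eventually_root_ge[OF r, of B]
      eventually_gt_at_top[of 0]
  proof eventually_elim
    case (elim t)
    define x where "x = real t powr (1 / r)"
    note x = elim[folded x_def]
    define s where "s = nat \<lfloor>x\<rfloor>"
    have s: "real s \<le> x" "x - 1 < real s" unfolding s_def using x(2) by linarith+
    have "T \<le> s" using s x(1) by linarith
    have "x ^ (k + 2) = x powr r"
      unfolding r_def using x(2) by (intro powr_realpow[symmetric]) simp
    also have "\<dots> = real t" unfolding x_def using r x(5) by (simp add: powr_powr)
    finally have xt: "x ^ (k + 2) = real t" .
    have "real ((2 * s + 2) ^ Suc k) = (2 * real s + 2) ^ Suc k"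
      by (simp only: of_nat_power of_nat_add of_nat_mult of_nat_numeral)
    also have "\<dots> \<le> (3 * x) ^ Suc k" using s x(2) by (intro power_mono) auto
    also have "\<dots> = 3 ^ Suc k * x ^ Suc k" by (rule power_mult_distrib)
    also have "\<dots> < x * x ^ Suc k" using x(2,3) by (intro mult_strict_right_mono) auto
    also have "\<dots> = real t" using xt by simp
    finally have st: "(2 * s + 2) ^ Suc k < t" by (simp only: of_nat_less_iff)
    define y where "y = x powr (c / 2)"
    have "(2 * 2 powr c) = B powr (c / 2)" unfolding B_def using assms(3) by (simp add: powr_powr)
    also have "\<dots> \<le> y" unfolding y_def using x(4) assms(3) by (intro powr_mono2) (auto simp: B_def)
    finally have y: "2 * 2 powr c \<le> y" .
    have "1 \<le> (2::real) powr c" using assms(3) by (intro ge_one_powr_ge_zero) auto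
    then have y1: "1 \<le> y" using y by simp
    have "(y + 1) * 2 powr c \<le> (2 * y) * 2 powr c" using y1 by (intro mult_right_mono) auto
    also have "\<dots> = y * (2 * 2 powr c)" by simp
    also have "\<dots> \<le> y * y" using y y1 by (intro mult_left_mono) auto
    also have "\<dots> = x powr c" unfolding y_def by (simp flip: powr_add)
    finally have "y + 1 \<le> x powr c / 2 powr c" by (simp add: pos_le_divide_eq)
    also have "\<dots> = (x / 2) powr c" using x(2) by (simp add: powr_divide)
    also have "\<dots> \<le> real s powr c" using s x(2) assms(3) by (intro powr_mono2) auto
    finally have ys: "y + 1 \<le> real s powr c" .
    have yt: "real t powr (c / (2 * (k + 2))) = y"
      unfolding y_def x_def r_def by (simp add: powr_powr mult.commute)
    show ?case
    proof (intro allI impI)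
      fix n :: nat
      assume n: "real n < 2 powr tower j (real t powr (c / (2 * (k + 2))))"
      define X where "X = tower j y"
      define M where "M = nat \<lceil>X\<rceil>"
      have "0 \<le> X" unfolding X_def using y1 by (intro tower_nonneg) simp
      then have M: "X \<le> real M" "real M < X + 1" unfolding M_def by linarith+
      have "real n < 2 powr X" using n unfolding yt X_def .
      also have "\<dots> \<le> 2 powr real M" using M by (intro powr_mono) auto
      also have "\<dots> = real (2 ^ M)" by (simp add: powr_realpow)
      finally have nM: "n \<le> 2 ^ M" by linarith
      have "real M < tower j y + 1" using M unfolding X_def by simp
      also have "\<dots> \<le> tower j (y + 1)" using y1 by (intro tower_add_one) simp
      also have "\<dots> \<le> tower j (real s powr c)" using ys by (rule tower_mono)
      finally have "\<not> few_colours_arrow k M s q 5" using T \<open>T \<le> s\<close> by blast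
      then show "\<not> few_colours_arrow (Suc k) n t (5 * q) 5"
        using assms(1,2) nM st by (intro not_few_colours_arrow_Suc[of k q M s]) auto
    qed
  qed
qed

text \<open>Induction on the uniformity, starting from T_2(t) = 2^t with \<open>c = 1\<close>.
  Failure is claimed for every \<open>n\<close> below the tower, so the least valid \<open>n\<close>
  is bounded without monotonicity in \<open>n\<close>.\<close>

lemma lower_bound:
  "\<exists>(q::nat) (c::real). q \<ge> 5 \<and> c > 0 \<and> (\<forall>\<^sub>F t in sequentially.
     \<forall>n. real n < tower (Suc (Suc i)) (real t powr c) \<longrightarrow> \<not> few_colours_arrow (i + 3) n t q 5)"
proof (induction i)
  case 0
  have "\<forall>\<^sub>F t in sequentially. \<forall>n. real n < tower (Suc (Suc 0)) (real t powr 1) \<longrightarrow>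
      \<not> few_colours_arrow (0 + 3) n t 5 5"
    using not_few_colours_arrow_3 by (rule eventually_mono) simp
  then show ?case by (intro exI[of _ 5] exI[of _ 1]) simp
next
  case (Suc i)
  then obtain q and c :: real where qc: "q \<ge> 5" "c > 0"
      "\<forall>\<^sub>F t in sequentially. \<forall>n. real n < tower (Suc (Suc i)) (real t powr c) \<longrightarrow>
        \<not> few_colours_arrow (i + 3) n t q 5" by blast
  have "\<forall>\<^sub>F t in sequentially. \<forall>n.
      real n < tower (Suc (Suc (Suc i))) (real t powr (c / (2 * (i + 3 + 2)))) \<longrightarrow>
      \<not> few_colours_arrow (Suc i + 3) n t (5 * q) 5"
    using lower_bound_Suc[OF _ qc(1,2,3)] by simp
  moreover have "5 * q \<ge> 5" "c / (2 * (i + 3 + 2)) > 0" using qc by auto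
  ultimately show ?case by blast
qed

theorem corollary1p4:
  fixes k :: nat
  assumes "k \<ge> 4"
  shows "\<exists>(q::nat) (c::real). q \<ge> 5 \<and> c > 0 \<and>
    (\<forall>\<^sub>F t in sequentially. real (ramsey_num k t q 5) \<ge> tower (k - 1) (real t powr c))"
proof -
  define i where "i = k - 3"
  have k: "k = i + 3" "k - 1 = Suc (Suc i)" using assms unfolding i_def by auto
  obtain q and c :: real where qc: "q \<ge> 5" "c > 0"
      "\<forall>\<^sub>F t in sequentially. \<forall>n. real n < tower (k - 1) (real t powr c) \<longrightarrow>
        \<not> few_colours_arrow k n t q 5" using lower_bound[of i, folded k] by blast
  have "\<forall>\<^sub>F t in sequentially. real (ramsey_num k t q 5) \<ge> tower (k - 1) (real t powr c)"
    using qc(3)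
  proof eventually_elim
    case (elim t)
    \<comment> \<open>By Ramsey's theorem the minimum is attained, so it cannot lie below the
      tower.\<close>
    have "few_colours_arrow k (ramsey_num k t q 5) t q 5"
      unfolding ramsey_num_def using few_colours_arrow_exists[of 5 k t q] by (auto intro: LeastI_ex)
    then show ?case using elim not_le by blast
  qed
  then show ?thesis using qc by blast
qed

end
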